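(* Let $K$ and $L$ be convex bodies in $\mathbb{R}^n$ and fix a slicing direction $\nu\in\mathbb{S}^{n-1}$. If the slicing support functions of $K$ and $L$ along $\nu$ satisfy $$h_{\nu,K}(u,p)=h_{\nu,L}(u,p)\qquad\text{for all }u\in\nu^\perp\text{ and all }p\in\mathbb{R},$$ then $h_K\equiv h_L$ on $\mathbb{R}^n$, and hence $K=L$.
   Context: For a convex body $K\subset\mathbb{R}^n$, the support function is $h_K(v)=\sup_{x\in K}x\cdot v$, $v\in\mathbb{R}^n$. For a unit vector $\nu\in\mathbb{S}^{n-1}$ write $\nu^\perp=\{x\in\mathbb{R}^n: x\cdot\nu=0\}$. The slicing support function of $K$ along $\nu$ is $h_{\nu,K}(u,p)=\sup\{x\cdot u: x\in K,\ x\cdot\nu=p\}$ for $u\in\nu^\perp$, $p\in\mathbb{R}$, with value $-\infty$ if $\{x\in K: x\cdot\nu=p\}$ is empty; similarly for $L$. *)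

theory Defs
  imports "HOL-Analysis.Analysis"
begin

(* Convention: convex bodies are nonempty, compact and convex; interior points are not required. *)
definition convex_body :: "(real ^ 'n) set \<Rightarrow> bool" where
  "convex_body K \<longleftrightarrow> convex K \<and> compact K \<and> K \<noteq> {}"

(* The real supremum is the intended one for nonempty bounded K, in particular for convex bodies. *)
definition support_fun :: "(real ^ 'n) set \<Rightarrow> real ^ 'n \<Rightarrow> real" where
  "support_fun K v = (SUP x\<in>K. x \<bullet> v)"

definition perp :: "real ^ 'n \<Rightarrow> (real ^ 'n) set" where
  "perp \<nu> = {x. x \<bullet> \<nu> = 0}"

(* Extended-real valued: the supremum over an empty slice is -\<infinity>. *)
definition slicing_support_fun ::
    "real ^ 'n \<Rightarrow> (real ^ 'n) set \<Rightarrow> real ^ 'n \<Rightarrow> real \<Rightarrow> ereal" where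
  "slicing_support_fun \<nu> K u p = (SUP x\<in>{x \<in> K. x \<bullet> \<nu> = p}. ereal (x \<bullet> u))"

lemma slicing_support_fun_empty:
  "{x \<in> K. x \<bullet> \<nu> = p} = {} \<Longrightarrow> slicing_support_fun \<nu> K u p = -\<infinity>"
  unfolding slicing_support_fun_def by (simp only: image_empty Sup_empty bot_ereal_def)

end

theory Submission
  imports Defs
begin

text \<open>A closed convex set is recovered from its slices: each slice is closed and convex, so
  functionals in \<open>perp \<nu>\<close> separate it from any other point at the same height. A
  point of \<open>K\<close> outside \<open>L\<close> would thus make the slicing support function of
  \<open>K\<close> exceed that of \<open>L\<close>. Applying this inclusion both ways gives
  \<open>K = L\<close>, from which equality of the support functions follows.\<close>

lemma subset_if_slicing_support_fun_le:
  fixes K L :: "(real ^ 'n) set" and \<nu> :: "real ^ 'n"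
  assumes "convex L" and "closed L" and \<nu>: "norm \<nu> = 1"
    and le: "\<And>u p. u \<in> perp \<nu> \<Longrightarrow> slicing_support_fun \<nu> K u p \<le> slicing_support_fun \<nu> L u p"
  shows "K \<subseteq> L"
proof (rule subsetI, rule ccontr)
  fix x assume "x \<in> K" "x \<notin> L"
  define p where "p = x \<bullet> \<nu>"
  define S where "S = {y \<in> L. y \<bullet> \<nu> = p}"
  have S_eq: "S = L \<inter> {y. \<nu> \<bullet> y = p}"
    by (auto simp: S_def inner_commute)
  have "convex S" "closed S" "x \<notin> S"
    using assms(1,2) \<open>x \<notin> L\<close>
    by (simp_all add: S_eq convex_Int convex_hyperplane closed_Int closed_hyperplane)
  then obtain a b where ab: "a \<bullet> x < b" "\<And>y. y \<in> S \<Longrightarrow> b < a \<bullet> y"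
    using separating_hyperplane_closed_point[of S x] by auto
  \<comment> \<open>Adding a multiple of \<open>\<nu>\<close> to the separating functional only shifts it by a constant
    on the slice, so it may be taken in \<open>perp \<nu>\<close>.\<close>
  define u where "u = (a \<bullet> \<nu>) *\<^sub>R \<nu> - a"
  have "u \<in> perp \<nu>"
    using \<nu> by (simp add: perp_def u_def inner_diff_left norm_eq_1)
  \<comment> \<open>The sign of \<open>a\<close> is reversed in \<open>u\<close>, so the lower bound
    \<open>b\<close> on \<open>S\<close> becomes an upper bound, as a supremum requires.\<close>
  have inner_u: "y \<bullet> u = (a \<bullet> \<nu>) * p - a \<bullet> y" if "y \<bullet> \<nu> = p" for y
    using that by (simp add: u_def inner_diff_right inner_commute)
  have "ereal (x \<bullet> u) \<le> slicing_support_fun \<nu> K u p"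
    unfolding slicing_support_fun_def using \<open>x \<in> K\<close> by (intro SUP_upper) (simp add: p_def)
  also have "\<dots> \<le> slicing_support_fun \<nu> L u p"
    using \<open>u \<in> perp \<nu>\<close> by (rule le)
  \<comment> \<open>The bound is uniform in \<open>y\<close>, so it passes to the supremum; an empty
    slice is covered too, its value being -\<infinity>.\<close>
  also have "\<dots> \<le> ereal ((a \<bullet> \<nu>) * p - b)"
    unfolding slicing_support_fun_def
  proof (rule SUP_least)
    fix y assume "y \<in> {y \<in> L. y \<bullet> \<nu> = p}"
    then show "ereal (y \<bullet> u) \<le> ereal ((a \<bullet> \<nu>) * p - b)"
      using ab(2)[of y] inner_u[of y] by (simp add: S_def)
  qed
  \<comment> \<open>The chain yields \<open>b \<le> a \<bullet> x\<close>, against strict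
    separation.\<close>
  finally show False
    using ab(1) inner_u[of x] by (simp add: p_def)
qed

theorem corollary3:
  fixes K L :: "(real ^ 'n) set" and \<nu> :: "real ^ 'n"
  assumes "convex_body K" and "convex_body L"
    and "\<nu> \<in> sphere 0 1"
    and "\<forall>u\<in>perp \<nu>. \<forall>p::real. slicing_support_fun \<nu> K u p = slicing_support_fun \<nu> L u p"
  shows "(\<forall>v. support_fun K v = support_fun L v) \<and> K = L"
proof -
  have "convex K" "closed K" "convex L" "closed L" "norm \<nu> = 1"
    using assms(1-3) by (auto simp: convex_body_def compact_imp_closed)
  then have "K = L"
    using assms(4) by (intro subset_antisym subset_if_slicing_support_fun_le[where \<nu> = \<nu>]) simp_all
  then show ?thesis
    by simp
qed

end
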